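(* Let $\mathbf{A},\mathbf{B}\in\mathbb{C}^{n\times n}$ with $\mathbf{A}$ singular, $\operatorname{Ind}\mathbf{A}=k$ and $\operatorname{rank}\mathbf{A}^{k+1}=\operatorname{rank}\mathbf{A}^{k}=r\ge 1$. For $l\ge 0$ put $\check{\mathbf{B}}^{(l)}=\mathbf{B}\mathbf{A}^{l}=(\check{b}^{(l)}_{ij})$ (so $\check b^{(0)}_{ij}=b_{ij}$), with $i$th row $\check{\mathbf{b}}^{(l)}_{i.}$. Consider the partial (particular) solution $$\mathbf{X}(t)=\mathbf{B}\mathbf{A}^{D}+\sum_{s=1}^{k}\frac{(-1)^{s-1}}{s!}\left(\mathbf{B}\mathbf{A}^{s-1}-\mathbf{B}\mathbf{A}^{s}\mathbf{A}^{D}\right)t^{s}$$ of the matrix differential equation $\mathbf{X}'+\mathbf{X}\mathbf{A}=\mathbf{B}$. Then its entries $x_{ij}=x_{ij}(t)$ have the determinantal representation $$x_{ij}=\frac{\sum_{\alpha\in I_{r,n}\{j\}}\left|\left(\mathbf{A}^{k+1}_{j.}\left(\check{\mathbf{b}}^{(k)}_{i.}\right)\right)^{\alpha}_{\alpha}\right|}{\sum_{\alpha\in I_{r,n}}\left|\left(\mathbf{A}^{k+1}\right)^{\alpha}_{\alpha}\right|}+\sum_{s=1}^{k}\frac{(-1)^{s-1}}{s!}\left(\check{b}^{(s-1)}_{ij}-\frac{\sum_{\alpha\in I_{r,n}\{j\}}\left|\left(\mathbf{A}^{k+1}_{j.}\left(\check{\mathbf{b}}^{(k+s)}_{i.}\right)\right)^{\alpha}_{\alpha}\right|}{\sum_{\alpha\in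 I_{r,n}}\left|\left(\mathbf{A}^{k+1}\right)^{\alpha}_{\alpha}\right|}\right)t^{s}$$ for all $i,j=1,\dots,n$.
   Context: For $\mathbf{A}\in\mathbb{C}^{n\times n}$, the index $\operatorname{Ind}\mathbf{A}$ is the smallest nonnegative integer $k$ with $\operatorname{rank}\mathbf{A}^{k+1}=\operatorname{rank}\mathbf{A}^{k}$. The Drazin inverse $\mathbf{A}^{D}$ of a matrix with $\operatorname{Ind}\mathbf A=k$ is the unique matrix $\mathbf{X}$ satisfying $\mathbf{A}^{k+1}\mathbf{X}=\mathbf{A}^{k}$, $\mathbf{X}\mathbf{A}\mathbf{X}=\mathbf{X}$, $\mathbf{A}\mathbf{X}=\mathbf{X}\mathbf{A}$. In the differential equation the unknown $\mathbf{X}=\mathbf{X}(t)$ is an $n\times n$ complex-matrix-valued function of the real variable $t$ and $'$ denotes $d/dt$. Notation: for a matrix $\mathbf{M}$ and a row vector $\mathbf{b}$, $\mathbf{M}_{j.}(\mathbf{b})$ is the matrix obtained from $\mathbf{M}$ by replacing its $j$th row with $\mathbf{b}$; $\mathbf{A}^{k+1}_{j.}(\mathbf{b})$ means $(\mathbf{A}^{k+1})_{j.}(\mathbf{b})$. $|\mathbf{M}^{\alpha}_{\alpha}|$ is the principal minor of $\mathbf{M}$ with rows and columns indexed by $\alpha$. For $1\le r\le n$, $I_{r,n}$ is the set of all strictly increasing sequences of $r$ integers from $\{1,\dots,n\}$ (equivalently, $r$-element subsets), and $I_{r,n}\{j\}=\{\alpha\in I_{r,n}: j\in\alpha\}$.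 *)

theory Defs
  imports
    Complex_Main
    "Jordan_Normal_Form.Matrix"
    "Jordan_Normal_Form.Determinant"
    "Jordan_Normal_Form.DL_Rank"
    "Jordan_Normal_Form.DL_Submatrix"
begin

text \<open>Rows, columns and entries are numbered from 0, so that the index range is
  \<open>{0, \<dots>, n - 1}\<close> in place of \<open>{1, \<dots>, n}\<close>.\<close>

definition mat_rank :: "complex mat \<Rightarrow> nat" where
  "mat_rank A = vec_space.rank (dim_row A) A"

definition mat_index :: "complex mat \<Rightarrow> nat" where
  "mat_index A = (LEAST k. mat_rank (A ^\<^sub>m (k + 1)) = mat_rank (A ^\<^sub>m k))"

definition is_drazin_inverse :: "complex mat \<Rightarrow> complex mat \<Rightarrow> bool" where
  "is_drazin_inverse A X \<longleftrightarrow>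
     X \<in> carrier_mat (dim_row A) (dim_row A) \<and>
     A ^\<^sub>m (mat_index A + 1) * X = A ^\<^sub>m mat_index A \<and>
     X * A * X = X \<and>
     A * X = X * A"

definition drazin_inverse :: "complex mat \<Rightarrow> complex mat" where
  "drazin_inverse A = (THE X. is_drazin_inverse A X)"

definition replace_row :: "'a mat \<Rightarrow> nat \<Rightarrow> 'a vec \<Rightarrow> 'a mat" where
  "replace_row M j b =
     mat (dim_row M) (dim_col M) (\<lambda>(p, q). if p = j then b $ q else M $$ (p, q))"

definition principal_minor :: "'a :: comm_ring_1 mat \<Rightarrow> nat set \<Rightarrow> 'a" where
  "principal_minor M \<alpha> = det (submatrix M \<alpha> \<alpha>)"

definition index_sets :: "nat \<Rightarrow> nat \<Rightarrow> nat set set" where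
  "index_sets r n = {\<alpha>. \<alpha> \<subseteq> {..<n} \<and> card \<alpha> = r}"

definition index_sets_containing :: "nat \<Rightarrow> nat \<Rightarrow> nat \<Rightarrow> nat set set" where
  "index_sets_containing r n j = {\<alpha> \<in> index_sets r n. j \<in> \<alpha>}"

text \<open>The type of matrices carries no topology, so differentiation is entrywise.\<close>

definition has_mat_derivative ::
  "nat \<Rightarrow> (real \<Rightarrow> complex mat) \<Rightarrow> complex mat \<Rightarrow> real \<Rightarrow> bool" where
  "has_mat_derivative n X D t \<longleftrightarrow>
     D \<in> carrier_mat n n \<and>
     (\<forall>i<n. \<forall>j<n. ((\<lambda>u. X u $$ (i, j)) has_vector_derivative D $$ (i, j)) (at t))"

text \<open>\<open>X\<close> solves the equation \<open>X' + X A = B\<close> on the whole real line.\<close>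

definition solves_mat_ode ::
  "nat \<Rightarrow> complex mat \<Rightarrow> complex mat \<Rightarrow> (real \<Rightarrow> complex mat) \<Rightarrow> bool" where
  "solves_mat_ode n A B X \<longleftrightarrow>
     (\<forall>t. X t \<in> carrier_mat n n \<and> (\<exists>D. has_mat_derivative n X D t \<and> D + X t * A = B))"

end

theory Submission
  imports Defs
    "Jordan_Normal_Form.Jordan_Normal_Form_Existence"
    "Jordan_Normal_Form.Jordan_Normal_Form_Uniqueness"
begin

text \<open>Put \<open>M = A\<^sup>k\<^sup>+\<^sup>1\<close>, let \<open>p = det (t I + M)\<close>, and for a row vector \<open>c\<close> let \<open>F c\<close> be the determinant of
  \<open>t I + M\<close> with row \<open>j\<close> replaced by \<open>c\<close>. The coefficients of \<open>t\<^sup>n\<^sup>-\<^sup>r\<close> in \<open>p\<close> and \<open>F c\<close> are the two sums of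
  principal minors. Expanding along row \<open>j\<close> gives \<open>F (x M) + t F x = x\<^sub>j p\<close>. As \<open>M\<close> and \<open>M\<^sup>2\<close> have the same
  kernel, of dimension \<open>n - r\<close>, the root \<open>0\<close> of \<open>p\<close> has order exactly \<open>n - r\<close>; iterating the identity,
  \<open>t\<^sup>n\<^sup>-\<^sup>r\<close> divides \<open>F x\<close> for every \<open>x\<close> in the row space of \<open>M\<^sup>n\<^sup>-\<^sup>r\<close>, in particular for the rows of any
  \<open>U A\<^sup>D\<close>. Comparing coefficients of \<open>t\<^sup>n\<^sup>-\<^sup>r\<close> yields \<open>x\<^sub>j\<close> as a quotient of sums of minors, with \<open>x M\<close> a row
  of \<open>U A\<^sup>k\<close>. That \<open>X\<close> solves the equation is a telescoping sum, since \<open>A\<^sup>k (I - A A\<^sup>D) = 0\<close>.\<close>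

section \<open>Principal minors as coefficients of determinants\<close>

text \<open>The Leibniz formula of the submatrix is carried over by \<open>pick \<alpha>\<close>,
  the increasing enumeration of \<alpha>; conjugation with a bijection keeps signs. With
  permutations of \<alpha> itself, the minors for different \<alpha> fit into one Leibniz sum over
  \<open>{..<n}\<close>.\<close>

lemma principal_minor_eq_sum_permutations:
  fixes M :: "'a :: comm_ring_1 mat"
  assumes M: "M \<in> carrier_mat n n" and \<alpha>: "\<alpha> \<subseteq> {..<n}"
  shows "principal_minor M \<alpha> = (\<Sum>p | p permutes \<alpha>. of_int (sign p) * (\<Prod>i\<in>\<alpha>. M $$ (i, p i)))"
proof -
  let ?m = "card \<alpha>" and ?S = "submatrix M \<alpha> \<alpha>"
  have fin: "finite \<alpha>"
    using \<alpha> finite_subset by blast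
  have \<alpha>_eq: "{i. i < n \<and> i \<in> \<alpha>} = \<alpha>"
    using \<alpha> by auto
  have S: "?S \<in> carrier_mat ?m ?m"
    using M by (intro carrier_matI) (simp_all add: dim_submatrix \<alpha>_eq)
  have S_index: "?S $$ (i, j) = M $$ (pick \<alpha> i, pick \<alpha> j)" if "i < ?m" "j < ?m" for i j
    using that M by (intro submatrix_index) (simp_all add: \<alpha>_eq)
  have inj: "inj_on (pick \<alpha>) {0..<?m}"
    by (rule linorder_inj_onI') (metis atLeastLessThan_iff nat_neq_iff pick_mono_le)
  have "pick \<alpha> ` {0..<?m} = \<alpha>"
    using inj pick_in_set_le[of _ \<alpha>] fin
    by (intro card_subset_eq) (auto simp: card_image)
  then have bij: "bij_betw (pick \<alpha>) {0..<?m} \<alpha>"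
    using inj by (simp add: bij_betw_def)
  \<comment> \<open>\<open>?f\<close> conjugates a permutation of positions into one of \<alpha>,
    and \<open>?g\<close> undoes this.\<close>
  let ?f = "map_permutation {0..<?m} (pick \<alpha>)"
  let ?g = "map_permutation \<alpha> (inv_into {0..<?m} (pick \<alpha>))"
  have "det ?S = (\<Sum>p | p permutes {0..<?m}. of_int (sign p) * (\<Prod>i = 0..<?m. ?S $$ (i, p i)))"
    by (rule det_def'[OF S])
  also have "\<dots> = (\<Sum>p | p permutes \<alpha>. of_int (sign p) * (\<Prod>i\<in>\<alpha>. M $$ (i, p i)))"
  proof (rule sum.reindex_bij_witness[of _ ?g ?f])
    fix p assume p: "p \<in> {p. p permutes {0..<?m}}"
    then show "?g (?f p) = p"
      using bij inj by (intro map_permutation_compose_inv) auto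
    show "?f p \<in> {p. p permutes \<alpha>}"
      using p bij by (auto intro: map_permutation_permutes)
    have "(\<Prod>i\<in>\<alpha>. M $$ (i, ?f p i)) = (\<Prod>i = 0..<?m. M $$ (pick \<alpha> i, ?f p (pick \<alpha> i)))"
      using bij by (rule prod.reindex_bij_betw[symmetric])
    also have "\<dots> = (\<Prod>i = 0..<?m. ?S $$ (i, p i))"
    proof (rule prod.cong)
      fix i assume "i \<in> {0..<?m}"
      moreover from this p have "p i \<in> {0..<?m}"
        using permutes_in_image by fastforce
      ultimately show "M $$ (pick \<alpha> i, ?f p (pick \<alpha> i)) = ?S $$ (i, p i)"
        using inj by (simp add: S_index map_permutation_apply)
    qed simp
    finally show "of_int (sign (?f p)) * (\<Prod>i\<in>\<alpha>. M $$ (i, ?f p i)) =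
        of_int (sign p) * (\<Prod>i = 0..<?m. ?S $$ (i, p i))"
      using p inj by (simp add: sign_map_permutation)
  next
    fix p assume p: "p \<in> {p. p permutes \<alpha>}"
    have bij': "bij_betw (inv_into {0..<?m} (pick \<alpha>)) \<alpha> {0..<?m}"
      using bij by (rule bij_betw_inv_into)
    show "?f (?g p) = p"
      using bij' p bij by (intro map_permutation_compose_inv) (auto simp: bij_betw_inv_into_right)
    show "?g p \<in> {p. p permutes {0..<?m}}"
      using bij' p by (auto intro: map_permutation_permutes)
  qed
  finally show ?thesis
    by (simp add: principal_minor_def)
qed

text \<open>Expand the product over the rows in the Leibniz formula: \<alpha> records the rows whose
  factor comes from M. The diagonal factors of the other rows force p to fix them, and what is left
  is the Leibniz sum for \<alpha>.\<close>

lemma det_diag_add: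
  fixes M :: "'a :: comm_ring_1 mat"
  assumes M: "M \<in> carrier_mat n n"
  shows "det (mat n n (\<lambda>(i, j). (if i = j then d i else 0) + M $$ (i, j))) =
    (\<Sum>\<alpha>\<in>Pow {..<n}. (\<Prod>i\<in>{..<n} - \<alpha>. d i) * principal_minor M \<alpha>)"
    (is "det ?D = _")
proof -
  let ?P = "{p. p permutes {..<n}}"
  have fixed: "(\<Prod>i\<in>{..<n} - \<alpha>. if i = p i then d i else 0) =
      (if p permutes \<alpha> then \<Prod>i\<in>{..<n} - \<alpha>. d i else 0)"
    if p: "p permutes {..<n}" and \<alpha>: "\<alpha> \<subseteq> {..<n}" for p \<alpha>
  proof (cases "p permutes \<alpha>")
    case True
    then show ?thesis
      by (auto intro!: prod.cong dest: permutes_not_in)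
  next
    case False
    then obtain i where "i \<in> {..<n} - \<alpha>" "p i \<noteq> i"
      using p \<alpha> permutes_superset[of p "{..<n}" \<alpha>] by blast
    with False show ?thesis
      by (auto intro!: prod_zero bexI[of _ i])
  qed
  have less: "p i < n" if "p permutes {..<n}" "i < n" for p i
    using permutes_in_image[OF that(1), of i] that(2) by simp
  have "det ?D = (\<Sum>p\<in>?P. of_int (sign p) *
      (\<Prod>i<n. (if i = p i then d i else 0) + M $$ (i, p i)))"
    by (subst det_def'[of _ n])
      (auto intro!: sum.cong prod.cong arg_cong2[where f = "(*)"] simp: atLeast0LessThan less)
  also have "\<dots> = (\<Sum>p\<in>?P. \<Sum>\<alpha>\<in>Pow {..<n}. if p permutes \<alpha>
      then (\<Prod>i\<in>{..<n} - \<alpha>. d i) * (of_int (sign p) * (\<Prod>i\<in>\<alpha>. M $$ (i, p i))) else 0)"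
    by (subst add.commute, subst prod_add)
      (auto intro!: sum.cong simp: fixed sum_distrib_left mult.left_commute)
  also have "\<dots> = (\<Sum>\<alpha>\<in>Pow {..<n}. \<Sum>p\<in>?P. if p permutes \<alpha>
      then (\<Prod>i\<in>{..<n} - \<alpha>. d i) * (of_int (sign p) * (\<Prod>i\<in>\<alpha>. M $$ (i, p i))) else 0)"
    by (rule sum.swap)
  also have "\<dots> = (\<Sum>\<alpha>\<in>Pow {..<n}. (\<Prod>i\<in>{..<n} - \<alpha>. d i) * principal_minor M \<alpha>)"
  proof (rule sum.cong)
    fix \<alpha> assume \<alpha>: "\<alpha> \<in> Pow {..<n}"
    have eq: "{p. p permutes {..<n} \<and> p permutes \<alpha>} = {p. p permutes \<alpha>}"
      using \<alpha> permutes_subset by blast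
    show "(\<Sum>p\<in>?P. if p permutes \<alpha>
        then (\<Prod>i\<in>{..<n} - \<alpha>. d i) * (of_int (sign p) * (\<Prod>i\<in>\<alpha>. M $$ (i, p i))) else 0) =
      (\<Prod>i\<in>{..<n} - \<alpha>. d i) * principal_minor M \<alpha>"
      using \<alpha> by (subst sum.inter_filter[symmetric])
        (auto simp: eq finite_permutations principal_minor_eq_sum_permutations[OF M] sum_distrib_left)
  qed simp
  finally show ?thesis .
qed

section \<open>The pencil t I + M over the polynomial ring\<close>

lemma principal_minor_map_poly:
  fixes M :: "'a :: comm_ring_1 mat"
  assumes "M \<in> carrier_mat n n" "\<alpha> \<subseteq> {..<n}"
  shows "principal_minor (map_mat (\<lambda>a. [:a:]) M) \<alpha> = [:principal_minor M \<alpha>:]"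
proof -
  interpret comm_ring_hom "\<lambda>a :: 'a. [:a:]"
    by unfold_locales (auto simp: pCons_one)
  have "{i. i < n \<and> i \<in> \<alpha>} = \<alpha>"
    using assms by auto
  then have "submatrix (map_mat (\<lambda>a. [:a:]) M) \<alpha> \<alpha> = map_mat (\<lambda>a. [:a:]) (submatrix M \<alpha> \<alpha>)"
    using assms pick_in_set_le[of _ \<alpha>] unfolding submatrix_def
    by (intro eq_matI) (auto intro!: index_map_mat simp: subset_iff)
  then show ?thesis
    by (simp add: principal_minor_def)
qed

text \<open>With t = \<open>[:0, 1:]\<close> this is t I + M, the characteristic matrix of -M; the
  plus sign keeps alternating signs out of the sums of minors.\<close>

definition shift_mat :: "'a :: comm_ring_1 mat \<Rightarrow> 'a poly mat" where
  "shift_mat M = mat (dim_row M) (dim_col M)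
     (\<lambda>(i, j). (if i = j then [:0, 1:] else 0) + [:M $$ (i, j):])"

lemma shift_mat_carrier [simp]: "M \<in> carrier_mat n n \<Longrightarrow> shift_mat M \<in> carrier_mat n n"
  by (simp add: shift_mat_def)

text \<open>In \<open>det_diag_add\<close> with all diagonal terms equal to t, the set \<alpha>
  contributes its minor times t to the power \<open>n - card \<alpha>\<close>.\<close>

lemma coeff_det_shift_mat:
  assumes M: "M \<in> carrier_mat n n" and r: "r \<le> n"
  shows "coeff (det (shift_mat M)) (n - r) = (\<Sum>\<alpha>\<in>index_sets r n. principal_minor M \<alpha>)"
proof -
  have card_eq: "n - card \<alpha> = n - r \<longleftrightarrow> card \<alpha> = r" if "\<alpha> \<subseteq> {..<n}" for \<alpha>
    using r card_mono[OF _ that] by auto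
  have "shift_mat M = mat n n (\<lambda>(i, j). (if i = j then [:0, 1:] else 0) +
      map_mat (\<lambda>a. [:a:]) M $$ (i, j))"
    using M by (intro eq_matI) (auto simp: shift_mat_def)
  then have "det (shift_mat M) = (\<Sum>\<alpha>\<in>Pow {..<n}.
      (\<Prod>i\<in>{..<n} - \<alpha>. [:0, 1:]) * principal_minor (map_mat (\<lambda>a. [:a:]) M) \<alpha>)"
    using M by (simp only: det_diag_add[where n = n] map_carrier_mat)
  also have "\<dots> = (\<Sum>\<alpha>\<in>Pow {..<n}. monom (principal_minor M \<alpha>) (n - card \<alpha>))"
    using M by (intro sum.cong)
      (auto simp: principal_minor_map_poly card_Diff_subset finite_subset monom_altdef)
  finally have "coeff (det (shift_mat M)) (n - r) =
      (\<Sum>\<alpha>\<in>Pow {..<n}. if n - card \<alpha> = n - r then principal_minor M \<alpha> else 0)"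
    by (simp add: coeff_sum)
  also have "\<dots> = (\<Sum>\<alpha>\<in>{\<alpha> \<in> Pow {..<n}. n - card \<alpha> = n - r}. principal_minor M \<alpha>)"
    by (rule sum.inter_filter[symmetric]) simp
  also have "{\<alpha> \<in> Pow {..<n}. n - card \<alpha> = n - r} = index_sets r n"
    using card_eq by (auto simp: index_sets_def)
  finally show ?thesis .
qed

text \<open>The new row contains no t, so its diagonal term is 0 and the sets that omit j drop out
  of the expansion.\<close>

lemma coeff_det_replace_row_shift_mat:
  fixes M :: "'a :: comm_ring_1 mat"
  assumes M: "M \<in> carrier_mat n n" and r: "r \<le> n" and j: "j < n" and c: "c \<in> carrier_vec n"
  shows "coeff (det (replace_row (shift_mat M) j (map_vec (\<lambda>a. [:a:]) c))) (n - r) =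
    (\<Sum>\<alpha>\<in>index_sets_containing r n j. principal_minor (replace_row M j c) \<alpha>)"
proof -
  let ?N = "replace_row M j c"
  let ?d = "\<lambda>i. if i = j then 0 else [:0, 1 :: 'a:]"
  have card_eq: "n - card \<alpha> = n - r \<longleftrightarrow> card \<alpha> = r" if "\<alpha> \<subseteq> {..<n}" for \<alpha>
    using r card_mono[OF _ that] by auto
  have N: "?N \<in> carrier_mat n n"
    using M by (simp add: replace_row_def)
  have "replace_row (shift_mat M) j (map_vec (\<lambda>a. [:a:]) c) =
      mat n n (\<lambda>(p, q). (if p = q then ?d p else 0) + map_mat (\<lambda>a. [:a:]) ?N $$ (p, q))"
    using M c by (intro eq_matI) (auto simp: shift_mat_def replace_row_def)
  then have "det (replace_row (shift_mat M) j (map_vec (\<lambda>a. [:a:]) c)) = (\<Sum>\<alpha>\<in>Pow {..<n}.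
      (\<Prod>i\<in>{..<n} - \<alpha>. ?d i) * principal_minor (map_mat (\<lambda>a. [:a:]) ?N) \<alpha>)"
    using N by (simp only: det_diag_add[where n = n] map_carrier_mat)
  also have "\<dots> = (\<Sum>\<alpha>\<in>Pow {..<n}. if j \<in> \<alpha> then monom (principal_minor ?N \<alpha>) (n - card \<alpha>) else 0)"
  proof (rule sum.cong)
    fix \<alpha> assume \<alpha>: "\<alpha> \<in> Pow {..<n}"
    have "(\<Prod>i\<in>{..<n} - \<alpha>. ?d i) = (if j \<in> \<alpha> then [:0, 1 :: 'a:] ^ (n - card \<alpha>) else 0)"
    proof (cases "j \<in> \<alpha>")
      case True
      then have "(\<Prod>i\<in>{..<n} - \<alpha>. ?d i) = (\<Prod>i\<in>{..<n} - \<alpha>. [:0, 1:])"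
        by (intro prod.cong) auto
      then show ?thesis
        using True \<alpha> by (simp add: card_Diff_subset finite_subset)
    qed (use j in \<open>auto intro!: prod_zero\<close>)
    moreover have "principal_minor (map_mat (\<lambda>a. [:a:]) ?N) \<alpha> = [:principal_minor ?N \<alpha>:]"
      using \<alpha> by (intro principal_minor_map_poly[OF N]) simp
    ultimately show "(\<Prod>i\<in>{..<n} - \<alpha>. ?d i) * principal_minor (map_mat (\<lambda>a. [:a:]) ?N) \<alpha> =
        (if j \<in> \<alpha> then monom (principal_minor ?N \<alpha>) (n - card \<alpha>) else 0)"
      by (simp add: monom_altdef)
  qed simp
  finally have "coeff (det (replace_row (shift_mat M) j (map_vec (\<lambda>a. [:a:]) c))) (n - r) =
      (\<Sum>\<alpha>\<in>Pow {..<n}. if j \<in> \<alpha> \<and> n - card \<alpha> = n - r then principal_minor ?N \<alpha> else 0)"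
    by (auto simp: coeff_sum intro!: sum.cong)
  also have "\<dots> = (\<Sum>\<alpha>\<in>{\<alpha> \<in> Pow {..<n}. j \<in> \<alpha> \<and> n - card \<alpha> = n - r}. principal_minor ?N \<alpha>)"
    by (rule sum.inter_filter[symmetric]) simp
  also have "{\<alpha> \<in> Pow {..<n}. j \<in> \<alpha> \<and> n - card \<alpha> = n - r} = index_sets_containing r n j"
    using card_eq by (auto simp: index_sets_def index_sets_containing_def)
  finally show ?thesis .
qed

text \<open>Laplace expansion along row j: the cofactors of that row do not see its entries, so they
  can be read off the adjugate of the original matrix.\<close>

lemma det_replace_row:
  assumes A: "A \<in> carrier_mat n n" and j: "j < n"
  shows "det (replace_row A j c) = (\<Sum>b<n. c $ b * adj_mat A $$ (b, j))"
proof -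
  have R: "replace_row A j c \<in> carrier_mat n n"
    using A by (simp add: replace_row_def)
  have "mat_delete (replace_row A j c) j b = mat_delete A j b" for b
    using A by (intro eq_matI) (auto simp: mat_delete_def replace_row_def)
  then have "cofactor (replace_row A j c) j b = adj_mat A $$ (b, j)" if "b < n" for b
    using A j that by (simp add: adj_mat_def cofactor_def)
  moreover have "replace_row A j c $$ (j, b) = c $ b" if "b < n" for b
    using A j that by (simp add: replace_row_def)
  ultimately show ?thesis
    unfolding laplace_expansion_row[OF R j] by (intro sum.cong) simp_all
qed

text \<open>Row i of W M plus t times row i of W is row i of W (t I + M). Multiplying by column j of
  the adjugate of t I + M leaves entry (i, j) of W times the determinant.\<close>

lemma det_replace_row_shift_mat_mult:
  fixes M W :: "'a :: comm_ring_1 mat"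
  assumes M: "M \<in> carrier_mat n n" and W: "W \<in> carrier_mat m n" and i: "i < m" and j: "j < n"
  defines "F \<equiv> \<lambda>c. det (replace_row (shift_mat M) j (map_vec (\<lambda>a. [:a:]) c))"
  shows "F (row (W * M) i) + [:0, 1:] * F (row W i) = [:W $$ (i, j):] * det (shift_mat M)"
proof -
  let ?Q = "shift_mat M"
  have Q: "?Q \<in> carrier_mat n n"
    using M by simp
  have const_sum: "[:\<Sum>a\<in>S. f a:] = (\<Sum>a\<in>S. [:f a:])" for S :: "nat set" and f :: "nat \<Rightarrow> 'a"
  proof (induction S rule: infinite_finite_induct)
    case (insert x S)
    have "[:f x + sum f S:] = [:f x:] + [:sum f S:]"
      by simp
    with insert show ?case
      by (simp del: add_pCons)
  qed simp_all
  have adj: "(\<Sum>b<n. ?Q $$ (a, b) * adj_mat ?Q $$ (b, j)) = (if a = j then det ?Q else 0)"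
    if "a < n" for a
  proof -
    have "(\<Sum>b<n. ?Q $$ (a, b) * adj_mat ?Q $$ (b, j)) = (?Q * adj_mat ?Q) $$ (a, j)"
      using that j Q adj_mat(1)[OF Q]
      by (auto simp: scalar_prod_def atLeast0LessThan intro!: sum.cong)
    then show ?thesis
      using that j by (simp add: adj_mat(2)[OF Q])
  qed
  have entry: "[:row (W * M) i $ b:] + [:0, 1:] * [:row W i $ b:] =
      (\<Sum>a<n. [:W $$ (i, a):] * ?Q $$ (a, b))" if b: "b < n" for b
  proof -
    have "(\<Sum>a<n. [:W $$ (i, a):] * ?Q $$ (a, b)) =
        (\<Sum>a<n. if a = b then [:0, 1:] * [:W $$ (i, a):] else 0) + (\<Sum>a<n. [:W $$ (i, a) * M $$ (a, b):])"
      unfolding sum.distrib[symmetric] using M b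
      by (intro sum.cong) (auto simp: shift_mat_def algebra_simps)
    then show ?thesis
      using M W i b by (simp add: scalar_prod_def atLeast0LessThan const_sum)
  qed
  have "F (row (W * M) i) + [:0, 1:] * F (row W i) =
      (\<Sum>b<n. ([:row (W * M) i $ b:] + [:0, 1:] * [:row W i $ b:]) * adj_mat ?Q $$ (b, j))"
    using M W i unfolding F_def det_replace_row[OF Q j] sum_distrib_left sum.distrib[symmetric]
    by (intro sum.cong) (simp_all add: distrib_right mult.assoc del: mult_pCons_left mult_pCons_right)
  also have "\<dots> = (\<Sum>b<n. \<Sum>a<n. [:W $$ (i, a):] * (?Q $$ (a, b) * adj_mat ?Q $$ (b, j)))"
    by (intro sum.cong) (simp_all only: entry lessThan_iff sum_distrib_right mult.assoc)
  also have "\<dots> = (\<Sum>a<n. [:W $$ (i, a):] * (\<Sum>b<n. ?Q $$ (a, b) * adj_mat ?Q $$ (b, j)))"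
    by (subst sum.swap) (simp only: sum_distrib_left)
  also have "\<dots> = (\<Sum>a<n. if a = j then [:W $$ (i, a):] * det ?Q else 0)"
    by (intro sum.cong) (simp_all add: adj)
  also have "\<dots> = [:W $$ (i, j):] * det ?Q"
    using j by simp
  finally show ?thesis .
qed

text \<open>The preceding identity expresses \<open>F\<close> at x M through t times
  \<open>F\<close> at x and a multiple of the determinant. Each factor M thus gains a factor t, as
  long as the determinant is divisible by that power of t.\<close>

lemma power_dvd_det_replace_row_shift_mat:
  fixes M W :: "'a :: idom mat"
  assumes M: "M \<in> carrier_mat n n" and W: "W \<in> carrier_mat m n" and i: "i < m" and j: "j < n"
    and dvd: "[:0, 1:] ^ d dvd det (shift_mat M)" and l: "l \<le> d"
  shows "[:0, 1:] ^ l dvd det (replace_row (shift_mat M) j (map_vec (\<lambda>a. [:a:]) (row (W * M ^\<^sub>m l) i)))"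
  using l
proof (induction l)
  case (Suc l)
  let ?F = "\<lambda>c. det (replace_row (shift_mat M) j (map_vec (\<lambda>a. [:a:]) c))"
  have "W * M ^\<^sub>m l * M = W * M ^\<^sub>m Suc l"
    using M W by (simp add: assoc_mult_mat[of _ m n _ n _ n])
  then have "?F (row (W * M ^\<^sub>m Suc l) i) + [:0, 1:] * ?F (row (W * M ^\<^sub>m l) i) =
      [:(W * M ^\<^sub>m l) $$ (i, j):] * det (shift_mat M)"
    using det_replace_row_shift_mat_mult[OF M _ i j, of "W * M ^\<^sub>m l"] M W by simp
  then have "?F (row (W * M ^\<^sub>m Suc l) i) =
      [:(W * M ^\<^sub>m l) $$ (i, j):] * det (shift_mat M) - [:0, 1:] * ?F (row (W * M ^\<^sub>m l) i)"
    by (simp only: eq_diff_eq)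
  moreover have "[:0, 1:] ^ Suc l dvd det (shift_mat M)"
    using Suc.prems dvd by (meson dvd_trans le_imp_power_dvd)
  moreover have "[:0, 1:] ^ Suc l dvd [:0, 1:] * ?F (row (W * M ^\<^sub>m l) i)"
    using Suc by (simp del: mult_pCons_left)
  ultimately show ?case
    by (simp only: dvd_diff dvd_mult)
qed simp

text \<open>A form of Cramer's rule that allows singular M: instead of determinants, the
  coefficients of t^(n - r) in the identity for W are compared.\<close>

lemma sum_principal_minors_replace_row:
  fixes M W :: "'a :: idom mat"
  assumes M: "M \<in> carrier_mat n n" and W: "W \<in> carrier_mat m n" and i: "i < m" and j: "j < n"
    and r: "r \<le> n" and dvd: "[:0, 1:] ^ (n - r) dvd det (shift_mat M)"
    and WV: "W = V * M ^\<^sub>m (n - r)" and V: "V \<in> carrier_mat m n"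
  shows "(\<Sum>\<alpha>\<in>index_sets_containing r n j. principal_minor (replace_row M j (row (W * M) i)) \<alpha>) =
    W $$ (i, j) * (\<Sum>\<alpha>\<in>index_sets r n. principal_minor M \<alpha>)"
proof -
  let ?F = "\<lambda>c. det (replace_row (shift_mat M) j (map_vec (\<lambda>a. [:a:]) c))"
  obtain q where q: "?F (row W i) = [:0, 1:] ^ (n - r) * q"
    using power_dvd_det_replace_row_shift_mat[OF M V i j dvd order_refl] unfolding WV dvd_def by blast
  \<comment> \<open>Since t^(n - r) divides \<open>?F (row W i)\<close>, after one more factor t
    nothing of degree n - r remains.\<close>
  have "[:0, 1:] * ?F (row W i) = monom 1 (Suc (n - r)) * q"
    by (simp add: q monom_altdef mult.assoc del: mult_pCons_left)
  then have 0: "coeff ([:0, 1:] * ?F (row W i)) (n - r) = 0"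
    by (simp only: coeff_monom_mult) simp
  have "?F (row (W * M) i) + [:0, 1:] * ?F (row W i) = [:W $$ (i, j):] * det (shift_mat M)"
    by (rule det_replace_row_shift_mat_mult[OF M W i j])
  then have "coeff (?F (row (W * M) i)) (n - r) + coeff ([:0, 1:] * ?F (row W i)) (n - r) =
      W $$ (i, j) * coeff (det (shift_mat M)) (n - r)"
    by (metis (no_types, lifting) coeff_add coeff_smult mult_pCons_left mult_zero_left pCons_0_0 add.right_neutral)
  then show ?thesis
    using M W i r j by (simp add: 0 coeff_det_shift_mat coeff_det_replace_row_shift_mat del: mult_pCons_left)
qed

section \<open>Kernels and the order of the root 0\<close>

text \<open>The rank-nullity theorem for multiplication by A, whose image is the column space and
  whose kernel is \<open>mat_kernel A\<close>.\<close>

lemma rank_plus_kernel_dim: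
  fixes A :: "'a :: field mat"
  assumes A: "A \<in> carrier_mat n nc"
  shows "vec_space.rank n A + kernel_dim A = nc"
proof -
  interpret K: kernel n nc A
    by unfold_locales (rule A)
  interpret W: vec_space "TYPE('a)" n .
  have hom: "(*\<^sub>v) A \<in> LinearCombinations.module_hom class_ring K.NC.V W.V"
    unfolding LinearCombinations.module_hom_def mem_Collect_eq
  proof (intro conjI allI impI)
    show "(*\<^sub>v) A \<in> carrier K.NC.V \<rightarrow> carrier W.V"
      using A by (auto simp: module_vec_simps)
  next
    fix u v :: "'a vec" assume "u \<in> carrier K.NC.V \<and> v \<in> carrier K.NC.V"
    then show "A *\<^sub>v (u \<oplus>\<^bsub>K.NC.V\<^esub> v) = A *\<^sub>v u \<oplus>\<^bsub>W.V\<^esub> A *\<^sub>v v"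
      using A by (simp add: module_vec_simps mult_add_distrib_mat_vec)
  next
    fix a :: 'a and v :: "'a vec" assume "a \<in> carrier class_ring \<and> v \<in> carrier K.NC.V"
    then show "A *\<^sub>v (a \<odot>\<^bsub>K.NC.V\<^esub> v) = a \<odot>\<^bsub>W.V\<^esub> (A *\<^sub>v v)"
      using A by (simp add: module_vec_simps mult_mat_vec)
  qed
  interpret L: linear_map class_ring "module_vec TYPE('a) nc" "module_vec TYPE('a) n" "(*\<^sub>v) A"
    using vec_vs[of nc] vec_vs[of n] hom
    unfolding linear_map_def mod_hom_def mod_hom_axioms_def vectorspace_def by blast
  have im: "L.imT = W.span (set (cols A))"
    unfolding W.col_space_def[symmetric] W.col_space_eq[OF A]
    using A by (auto simp: L.im_def module_vec_simps)
  have ker: "L.kerT = mat_kernel A"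
    using A by (auto simp: L.ker_def mat_kernel_def module_vec_simps)
  show ?thesis
    using L.rank_nullity[OF K.NC.fin_dim] A
    unfolding im ker W.rank_def kernel_dim_def K.NC.dim_is_n by simp
qed

text \<open>A basis of the smaller kernel stays independent in the larger one and has as many
  vectors as its dimension, hence is a basis there too.\<close>

lemma mat_kernel_eqI:
  fixes A B :: "'a :: field mat"
  assumes A: "A \<in> carrier_mat nr nc" and B: "B \<in> carrier_mat nr' nc"
    and sub: "mat_kernel A \<subseteq> mat_kernel B" and dim: "kernel_dim A = kernel_dim B"
  shows "mat_kernel A = mat_kernel B"
proof -
  interpret A: kernel nr nc A
    by unfold_locales (rule A)
  interpret B: kernel nr' nc B
    by unfold_locales (rule B)
  obtain S where S: "finite S" "A.basis S"
    using kernel_basis_exists[OF A] by blast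
  then have S_A: "S \<subseteq> mat_kernel A" "A.lin_indpt S" "A.span S = mat_kernel A"
    by (auto simp: A.Ker.basis_def)
  obtain T where "finite T" "B.basis T"
    using kernel_basis_exists[OF B] by blast
  then have fin: "B.Ker.fin_dim"
    unfolding B.Ker.fin_dim_def B.Ker.basis_def by auto
  have "B.lin_indpt S"
    using S_A sub A.lindep_same B.lindep_same by auto
  moreover have "card S = B.dim"
    using A.Ker.dim_basis[OF S] dim A B by (simp add: kernel_dim_def)
  ultimately have "B.basis S"
    using S S_A sub fin by (intro B.Ker.dim_li_is_basis) auto
  then have "B.span S = mat_kernel B"
    by (auto simp: B.Ker.basis_def)
  moreover have "B.span S = A.span S"
    using S_A(1) sub by (simp only: A.span_same B.span_same subset_trans)
  ultimately show ?thesis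
    using S_A(3) by simp
qed

text \<open>In a Jordan form, the kernels of A and of its square have as dimensions the sums of
  \<open>min 1 n\<close> and \<open>min 2 n\<close> over the sizes n of the blocks for 0. If these
  agree, all such blocks have size at most 1, so the algebraic and geometric multiplicities of 0
  coincide.\<close>

lemma order_0_char_poly:
  fixes A :: "complex mat"
  assumes A: "A \<in> carrier_mat n n" and ker: "mat_kernel (A * A) = mat_kernel A"
  shows "order 0 (char_poly A) = kernel_dim A"
proof -
  obtain as where "char_poly A = (\<Prod>a\<leftarrow>as. [:- a, 1:])"
    using char_poly_factorized[OF A] by blast
  then obtain n_as where jnf: "jordan_nf A n_as"
    using jordan_nf_exists[OF A] by blast
  let ?ns = "map fst (filter (\<lambda>na. snd na = 0) n_as)"
  have ns: "map fst [(n, e)\<leftarrow>n_as. e = 0] = ?ns"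
    by (simp add: case_prod_beta')
  \<comment> \<open>The generalised eigenspaces for the value 0 are the kernels of the powers of A
    itself.\<close>
  have char: "char_matrix A 0 = A"
    using A by (intro eq_matI) (auto simp: char_matrix_def)
  have sum_list_min: "sum_list xs = (\<Sum>n\<leftarrow>xs. min 1 n)"
    if "(\<Sum>n\<leftarrow>xs. min 2 n) = (\<Sum>n\<leftarrow>xs. min 1 n)" for xs :: "nat list"
    using that
  proof (induction xs)
    case (Cons x xs)
    have "(\<Sum>n\<leftarrow>xs. min 1 n) \<le> (\<Sum>n\<leftarrow>xs. min 2 n)"
      by (intro sum_list_mono) auto
    moreover have "min 1 x \<le> min 2 x"
      by simp
    ultimately have "min 1 x = min 2 x" "(\<Sum>n\<leftarrow>xs. min 2 n) = (\<Sum>n\<leftarrow>xs. min 1 n)"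
      using Cons.prems by simp_all
    moreover from this(1) have "min 1 x = x"
      by linarith
    ultimately show ?case
      using Cons.IH by simp
  qed simp
  have "kernel_dim A = (\<Sum>n\<leftarrow>?ns. min 1 n)"
    using dim_gen_eigenspace[OF jnf, of 0 1] A
    by (simp add: dim_gen_eigenspace_def char ns)
  moreover have "kernel_dim (A * A) = (\<Sum>n\<leftarrow>?ns. min 2 n)"
    using dim_gen_eigenspace[OF jnf, of 0 2] A
    by (simp add: dim_gen_eigenspace_def char ns numeral_2_eq_2)
  moreover have "kernel_dim (A * A) = kernel_dim A"
    using A by (simp add: kernel_dim_def ker)
  ultimately show ?thesis
    using jordan_nf_order[OF jnf, of 0] sum_list_min[of ?ns] by (simp only:)
qed

section \<open>The Cayley--Hamilton theorem\<close>

text \<open>Horner's scheme for p(A), so that induction over \<open>pCons\<close> follows the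
  recursion.\<close>

definition poly_mat :: "'a :: comm_ring_1 mat \<Rightarrow> 'a poly \<Rightarrow> 'a mat" where
  "poly_mat A p = fold_coeffs (\<lambda>a B. a \<cdot>\<^sub>m 1\<^sub>m (dim_row A) + A * B) p (0\<^sub>m (dim_row A) (dim_row A))"

context
  fixes A :: "'a :: comm_ring_1 mat" and n :: nat
  assumes A: "A \<in> carrier_mat n n"
begin

lemma poly_mat_0 [simp]: "poly_mat A 0 = 0\<^sub>m n n"
  using A by (simp add: poly_mat_def)

lemma poly_mat_pCons [simp]: "poly_mat A (pCons a p) = a \<cdot>\<^sub>m 1\<^sub>m n + A * poly_mat A p"
proof (cases "a = 0 \<and> p = 0")
  \<comment> \<open>\<open>pCons 0 0\<close> is the zero polynomial, on which
    \<open>fold_coeffs\<close> makes no step; the right-hand side is then the zero matrix as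
    well.\<close>
  case True
  then show ?thesis
    using A by (auto intro!: eq_matI)
next
  case False
  then show ?thesis
    using A unfolding poly_mat_def by (cases "p = 0") auto
qed

lemma poly_mat_carrier [simp]: "poly_mat A p \<in> carrier_mat n n"
  using A by (induction p) auto

lemma dim_poly_mat [simp]: "dim_row (poly_mat A p) = n" "dim_col (poly_mat A p) = n"
  by (rule carrier_matD[OF poly_mat_carrier])+

lemma poly_mat_add: "poly_mat A (p + q) = poly_mat A p + poly_mat A q"
proof (induction p q rule: poly_induct2)
  case (pCons a p b q)
  have "A * (poly_mat A p + poly_mat A q) = A * poly_mat A p + A * poly_mat A q"
    using A by (intro mult_add_distrib_mat) auto
  then show ?case
    using A pCons by (intro eq_matI) (auto simp: algebra_simps)
qed auto

lemma poly_mat_smult: "poly_mat A (smult c p) = c \<cdot>\<^sub>m poly_mat A p"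
proof (induction p)
  case (pCons a p)
  have "A * (c \<cdot>\<^sub>m poly_mat A p) = c \<cdot>\<^sub>m (A * poly_mat A p)"
    using A by (intro mult_smult_distrib) auto
  then show ?case
    using A pCons by (intro eq_matI) (auto simp: algebra_simps)
qed (auto intro!: eq_matI)

lemma poly_mat_mult: "poly_mat A (p * q) = poly_mat A p * poly_mat A q"
proof (induction p)
  case (pCons a p)
  have "(a \<cdot>\<^sub>m 1\<^sub>m n + A * poly_mat A p) * poly_mat A q =
      a \<cdot>\<^sub>m poly_mat A q + A * (poly_mat A p * poly_mat A q)"
    using A by (subst add_mult_distrib_mat[of _ n n]) (auto simp: assoc_mult_mat[of _ n n _ n _ n])
  then show ?case
    using A pCons by (auto simp: poly_mat_add poly_mat_smult intro!: eq_matI)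
qed auto

lemma poly_mat_sum: "poly_mat A (\<Sum>s\<in>S. f s) $$ (i, j) = (\<Sum>s\<in>S. poly_mat A (f s) $$ (i, j))"
  if "i < n" "j < n"
  using that by (induction S rule: infinite_finite_induct) (auto simp: poly_mat_add)

lemma poly_mat_uminus: "poly_mat A (- p) = - poly_mat A p"
  using poly_mat_smult[of "- 1" p] by (auto intro!: eq_matI)

lemma poly_mat_diff: "poly_mat A (p - q) = poly_mat A p - poly_mat A q"
  using poly_mat_add[of p "- q"] by (auto intro!: eq_matI simp: poly_mat_uminus)

lemma poly_mat_1 [simp]: "poly_mat A 1 = 1\<^sub>m n"
  using A by (auto simp: one_pCons intro!: eq_matI)

lemma poly_mat_X: "poly_mat A [:0, 1:] = A"
  using A by (auto intro!: eq_matI)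

lemma poly_mat_power: "poly_mat A (p ^ l) = poly_mat A p ^\<^sub>m l"
proof (induction l)
  case (Suc l)
  then show ?case
    by (simp only: power_Suc2 poly_mat_mult pow_mat.simps)
qed auto

text \<open>Evaluating \<open>P (t I - A)\<close> at \<open>A\<close> with the coefficient matrices of \<open>P\<close> on the left gives \<open>0\<close>;
  for the adjugate \<open>P\<close> of \<open>t I - A\<close> this is the claim.\<close>

theorem cayley_hamilton: "poly_mat A (char_poly A) = 0\<^sub>m n n"
proof (rule eq_matI)
  let ?Q = "char_poly_matrix A"
  let ?P = "adj_mat ?Q"
  have Q: "?Q \<in> carrier_mat n n"
    using A by simp
  note P = adj_mat(1)[OF Q]
  fix i j assume "i < dim_row (0\<^sub>m n n :: 'a mat)" "j < dim_col (0\<^sub>m n n :: 'a mat)"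
  then have ij: "i < n" "j < n"
    by auto
  have PQ: "(\<Sum>b<n. ?P $$ (i, b) * ?Q $$ (b, a)) = (if i = a then char_poly A else 0)" if "a < n" for a
  proof -
    have "(\<Sum>b<n. ?P $$ (i, b) * ?Q $$ (b, a)) = (?P * ?Q) $$ (i, a)"
      using that ij P Q by (auto simp: scalar_prod_def atLeast0LessThan intro!: sum.cong)
    then show ?thesis
      using that ij by (simp add: adj_mat(3)[OF Q] char_poly_def)
  qed
  \<comment> \<open>The entrywise form of the fact that t I - A vanishes at t = A: summed over a,
    the two terms become the entry (b, c) of A minus itself.\<close>
  have zero: "(\<Sum>a<n. poly_mat A (?Q $$ (b, a)) $$ (a, c)) = 0" if "b < n" "c < n" for b c
  proof -
    have "poly_mat A (?Q $$ (b, a)) $$ (a, c) =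
        (if a = b then A $$ (a, c) else 0) - (if a = c then A $$ (b, a) else 0)" if "a < n" for a
    proof -
      have "?Q $$ (b, a) = (if a = b then [:0, 1:] else 0) - [:A $$ (b, a):]"
        using A that \<open>b < n\<close> by (auto simp: char_poly_matrix_def)
      moreover have "poly_mat A [:x:] = x \<cdot>\<^sub>m 1\<^sub>m n" for x
        using A by (auto intro!: eq_matI)
      ultimately show ?thesis
        using A that \<open>b < n\<close> \<open>c < n\<close> by (auto simp: poly_mat_diff poly_mat_X simp del: poly_mat_pCons)
    qed
    then show ?thesis
      using that by (simp add: sum_subtractf)
  qed
  have "poly_mat A (char_poly A) $$ (i, j) =
      (\<Sum>a<n. poly_mat A (if i = a then char_poly A else 0) $$ (a, j))"
  proof -
    have "(\<Sum>a<n. poly_mat A (if i = a then char_poly A else 0) $$ (a, j)) =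
        (\<Sum>a<n. if i = a then poly_mat A (char_poly A) $$ (a, j) else 0)"
      using ij by (intro sum.cong) auto
    then show ?thesis
      using ij by simp
  qed
  also have "\<dots> = (\<Sum>a<n. poly_mat A (\<Sum>b<n. ?P $$ (i, b) * ?Q $$ (b, a)) $$ (a, j))"
    by (intro sum.cong) (simp_all add: PQ)
  also have "\<dots> = (\<Sum>a<n. \<Sum>b<n. \<Sum>c<n.
      poly_mat A (?Q $$ (b, a)) $$ (a, c) * poly_mat A (?P $$ (i, b)) $$ (c, j))"
  proof (intro sum.cong refl)
    fix a assume "a \<in> {..<n}"
    then show "poly_mat A (\<Sum>b<n. ?P $$ (i, b) * ?Q $$ (b, a)) $$ (a, j) = (\<Sum>b<n. \<Sum>c<n.
      poly_mat A (?Q $$ (b, a)) $$ (a, c) * poly_mat A (?P $$ (i, b)) $$ (c, j))"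
      \<comment> \<open>The factor from \<open>?Q\<close> is put first so that the row index a falls
        on its evaluation; after the two swaps below, the inner sum over a is the one that vanishes
        by \<open>zero\<close>.\<close>
      using ij unfolding mult.commute[of "?P $$ _"]
      by (auto simp: poly_mat_sum poly_mat_mult scalar_prod_def atLeast0LessThan intro!: sum.cong)
  qed
  also have "\<dots> = (\<Sum>b<n. \<Sum>a<n. \<Sum>c<n.
      poly_mat A (?Q $$ (b, a)) $$ (a, c) * poly_mat A (?P $$ (i, b)) $$ (c, j))"
    by (rule sum.swap)
  also have "\<dots> = (\<Sum>b<n. \<Sum>c<n. \<Sum>a<n.
      poly_mat A (?Q $$ (b, a)) $$ (a, c) * poly_mat A (?P $$ (i, b)) $$ (c, j))"
    by (intro sum.cong refl sum.swap)
  also have "\<dots> = 0"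
    by (simp add: sum_distrib_right[symmetric] zero)
  finally show "poly_mat A (char_poly A) $$ (i, j) = 0\<^sub>m n n $$ (i, j)"
    using ij by simp
qed auto

end

section \<open>Existence and uniqueness of the Drazin inverse\<close>

lemma pow_mat_add:
  fixes A :: "'a :: semiring_1 mat"
  assumes A: "A \<in> carrier_mat n n"
  shows "A ^\<^sub>m (i + j) = A ^\<^sub>m i * A ^\<^sub>m j"
  using A by (induction j) (auto simp: assoc_mult_mat[of _ n n _ n _ n])

text \<open>Once the kernel stops growing it stays constant: applying the hypothesis to A^l v
  removes one factor A at a time.\<close>

lemma mat_kernel_pow_stable:
  fixes A :: "'a :: comm_ring_1 mat"
  assumes A: "A \<in> carrier_mat n n" and ker: "mat_kernel (A ^\<^sub>m (k + 1)) = mat_kernel (A ^\<^sub>m k)"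
  shows "mat_kernel (A ^\<^sub>m (l + k)) = mat_kernel (A ^\<^sub>m k)"
proof
  have pow: "A ^\<^sub>m i \<in> carrier_mat n n" for i
    using A by simp
  show "mat_kernel (A ^\<^sub>m k) \<subseteq> mat_kernel (A ^\<^sub>m (l + k))"
    unfolding pow_mat_add[OF A] by (rule mat_kernel_mult_subset[OF pow pow])
  show "mat_kernel (A ^\<^sub>m (l + k)) \<subseteq> mat_kernel (A ^\<^sub>m k)"
  proof (induction l)
    case (Suc l)
    have "mat_kernel (A ^\<^sub>m (Suc l + k)) \<subseteq> mat_kernel (A ^\<^sub>m (l + k))"
    proof
      fix v assume v: "v \<in> mat_kernel (A ^\<^sub>m (Suc l + k))"
      have v_carrier: "v \<in> carrier_vec n"
        using mat_kernelD(1)[OF pow v] .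
      have "A ^\<^sub>m (k + 1) *\<^sub>v (A ^\<^sub>m l *\<^sub>v v) = A ^\<^sub>m (k + 1 + l) *\<^sub>v v"
        unfolding pow_mat_add[OF A, of "k + 1" l] by (rule assoc_mult_mat_vec[symmetric, OF pow pow v_carrier])
      also have "k + 1 + l = Suc l + k"
        by simp
      also have "A ^\<^sub>m (Suc l + k) *\<^sub>v v = 0\<^sub>v n"
        by (rule mat_kernelD(2)[OF pow v])
      finally have "A ^\<^sub>m l *\<^sub>v v \<in> mat_kernel (A ^\<^sub>m k)"
        unfolding ker[symmetric] by (intro mat_kernelI[OF pow] mult_mat_vec_carrier[OF pow v_carrier])
      then have "A ^\<^sub>m k *\<^sub>v (A ^\<^sub>m l *\<^sub>v v) = 0\<^sub>v n"
        by (rule mat_kernelD(2)[OF pow])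
      also have "A ^\<^sub>m k *\<^sub>v (A ^\<^sub>m l *\<^sub>v v) = A ^\<^sub>m (k + l) *\<^sub>v v"
        unfolding pow_mat_add[OF A] by (rule assoc_mult_mat_vec[symmetric, OF pow pow v_carrier])
      finally show "v \<in> mat_kernel (A ^\<^sub>m (l + k))"
        using v_carrier by (intro mat_kernelI[OF pow]) (auto simp: add.commute)
    qed
    with Suc show ?case
      by simp
  qed simp
qed

text \<open>Translates annihilation into kernels, so that stabilisation can lower the exponent in an
  equation A^i E = 0.\<close>

lemma mat_mult_eq_0_iff_cols:
  fixes A :: "'a :: comm_ring_1 mat"
  assumes A: "A \<in> carrier_mat nr n" and B: "B \<in> carrier_mat n nc"
  shows "A * B = 0\<^sub>m nr nc \<longleftrightarrow> (\<forall>j<nc. col B j \<in> mat_kernel A)"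
proof
  assume AB: "A * B = 0\<^sub>m nr nc"
  show "\<forall>j<nc. col B j \<in> mat_kernel A"
  proof (intro allI impI)
    fix j assume j: "j < nc"
    then have "A *\<^sub>v col B j = col (A * B) j"
      by (rule col_mult2[OF A B, symmetric])
    then show "col B j \<in> mat_kernel A"
      using A B j by (intro mat_kernelI[OF A]) (auto simp: AB)
  qed
next
  assume ker: "\<forall>j<nc. col B j \<in> mat_kernel A"
  show "A * B = 0\<^sub>m nr nc"
  proof (rule mat_col_eqI)
    fix j assume j: "j < dim_col (0\<^sub>m nr nc :: 'a mat)"
    then have "col (A * B) j = A *\<^sub>v col B j"
      using col_mult2[OF A B] by simp
    then show "col (A * B) j = col (0\<^sub>m nr nc) j"
      using ker j mat_kernelD(2)[OF A] by simp
  qed (use A B in auto)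
qed

text \<open>By rank-nullity, equal ranks give equal nullities, and one kernel contains the
  other.\<close>

lemma mat_kernel_eq_of_mat_rank_eq:
  assumes A: "A \<in> carrier_mat n n" and rank: "mat_rank (A ^\<^sub>m (k + 1)) = mat_rank (A ^\<^sub>m k)"
  shows "mat_kernel (A ^\<^sub>m (k + 1)) = mat_kernel (A ^\<^sub>m k)"
proof -
  have pow: "A ^\<^sub>m i \<in> carrier_mat n n" for i
    using A by simp
  have "mat_kernel (A ^\<^sub>m k) \<subseteq> mat_kernel (A ^\<^sub>m (1 + k))"
    unfolding pow_mat_add[OF A] by (rule mat_kernel_mult_subset[OF pow pow])
  moreover have "mat_rank (A ^\<^sub>m i) + kernel_dim (A ^\<^sub>m i) = n" for i
    using rank_plus_kernel_dim[OF pow[of i]] A by (simp add: mat_rank_def)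
  then have "kernel_dim (A ^\<^sub>m k) = kernel_dim (A ^\<^sub>m (k + 1))"
    by (metis rank add_left_cancel)
  ultimately show ?thesis
    using mat_kernel_eqI[OF pow pow] by (metis add.commute)
qed

lemma eq_mat_of_minus_eq_0:
  fixes A B :: "'a :: group_add mat"
  assumes A: "A \<in> carrier_mat nr nc" and B: "B \<in> carrier_mat nr nc" and AB: "A - B = 0\<^sub>m nr nc"
  shows "A = B"
proof (rule eq_matI)
  fix i j assume "i < dim_row B" "j < dim_col B"
  moreover from this have "(A - B) $$ (i, j) = 0"
    using B by (simp add: AB)
  ultimately show "A $$ (i, j) = B $$ (i, j)"
    by simp
qed (use A B in auto)

text \<open>The inverse is a polynomial f in A. If the characteristic polynomial is t^m q with q(0)
  \<noteq> 0, then f is taken as a multiple of t^m for which q divides 1 - t f, and Cayley-Hamilton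
  yields the equations. The power equation first appears with exponents that are too large;
  stabilisation of the kernels lowers them to the index.\<close>

lemma drazin_inverse_exists:
  assumes A: "A \<in> carrier_mat n n"
    and ker: "mat_kernel (A ^\<^sub>m (mat_index A + 1)) = mat_kernel (A ^\<^sub>m mat_index A)"
  shows "\<exists>X. is_drazin_inverse A X"
proof -
  let ?t = "[:0, 1 :: complex:]" and ?p = "char_poly A" and ?k = "mat_index A"
  define m where "m = order 0 ?p"
  have p: "?p \<noteq> 0"
    using degree_monic_char_poly[OF A] by auto
  obtain q where q: "?p = ?t ^ m * q" "\<not> ?t dvd q"
    using order_decomp[OF p, of 0] by (auto simp: m_def)
  obtain c q' where q': "q = pCons c q'"
    by (cases q)
  have c: "c \<noteq> 0"
    using q(2) unfolding q' by (auto simp: dvd_def)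
  \<comment> \<open>Chosen so that q = c (1 - t s); hence t s is 1 modulo q, and \<open>w\<close> is
    q up to a constant.\<close>
  define s where "s = smult (- 1 / c) q'"
  define u where "u = (\<Sum>i<Suc m. (?t * s) ^ i)"
  define w where "w = 1 - ?t * s"
  \<comment> \<open>Here t f = (t s)^(m + 1), so 1 - t f is \<open>w\<close> times the geometric sum
    \<open>u\<close>.\<close>
  define f where "f = ?t ^ m * s ^ Suc m"
  have "q = smult c w"
    using c by (simp add: w_def q' s_def one_pCons)
  then have "?t ^ m * w = smult (1 / c) ?p"
    using c by (simp add: q(1) mult_smult_right)
  \<comment> \<open>By Cayley-Hamilton, every multiple of t^m w vanishes at A.\<close>
  then have zero: "poly_mat A (?t ^ m * w * v) = 0\<^sub>m n n" for v
    using cayley_hamilton[OF A] A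
    by (auto simp: poly_mat_mult[OF A] poly_mat_smult[OF A] intro!: eq_matI)
  have tf: "1 - ?t * f = w * u"
    unfolding u_def f_def w_def one_diff_power_eq[symmetric]
    by (simp only: power_mult_distrib power_Suc ac_simps)
  define X where "X = poly_mat A f"
  have X: "X \<in> carrier_mat n n"
    using A by (simp add: X_def)
  have "poly_mat A (f * ?t * f - f) = poly_mat A (?t ^ m * w * (- (s ^ Suc m * u)))"
  proof (rule arg_cong[where f = "poly_mat A"])
    have "f * ?t * f - f = - (f * (1 - ?t * f))"
      by (simp only: right_diff_distrib mult_1_right minus_diff_eq mult.assoc)
    also have "\<dots> = ?t ^ m * w * (- (s ^ Suc m * u))"
      unfolding tf by (simp only: f_def mult_minus_left mult_minus_right ac_simps)
    finally show "f * ?t * f - f = ?t ^ m * w * (- (s ^ Suc m * u))" .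
  qed
  then have "X * A * X - X = 0\<^sub>m n n"
    unfolding zero
    by (simp only: poly_mat_diff[OF A] poly_mat_mult[OF A] poly_mat_X[OF A] X_def)
  from eq_mat_of_minus_eq_0[OF _ X this] have XAX: "X * A * X = X"
    using X A by simp
  have AX: "A * X = X * A"
  proof -
    have "poly_mat A (?t * f) = poly_mat A (f * ?t)"
      by (simp only: mult.commute)
    then show ?thesis
      by (simp only: poly_mat_mult[OF A] poly_mat_X[OF A] X_def)
  qed
  \<comment> \<open>This is I - A X, kept as the value of a polynomial so that its products with
    powers of A are computed among polynomials.\<close>
  define E where "E = poly_mat A (1 - ?t * f)"
  have E: "E \<in> carrier_mat n n"
    using A by (simp add: E_def)
  have pow: "A ^\<^sub>m i \<in> carrier_mat n n" for i
    using A by simp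
  have pow_E: "A ^\<^sub>m i * E = poly_mat A (?t ^ i * (1 - ?t * f))" for i
    by (simp only: E_def poly_mat_mult[OF A] poly_mat_power[OF A] poly_mat_X[OF A])
  have "A ^\<^sub>m (m + ?k) * E = poly_mat A (?t ^ m * w * (?t ^ ?k * u))"
    unfolding pow_E tf by (simp only: power_add ac_simps)
  then have "A ^\<^sub>m (m + ?k) * E = 0\<^sub>m n n"
    by (simp only: zero)
  \<comment> \<open>The columns of \<open>E\<close> lie in the kernel of A^(m + k), which equals
    that of A^k.\<close>
  then have "A ^\<^sub>m ?k * E = 0\<^sub>m n n"
    unfolding mat_mult_eq_0_iff_cols[OF pow E] mat_kernel_pow_stable[OF A ker] .
  moreover have "A ^\<^sub>m ?k * E = A ^\<^sub>m ?k - A ^\<^sub>m (?k + 1) * X"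
  proof -
    have "?t ^ ?k * (1 - ?t * f) = ?t ^ ?k - ?t ^ (?k + 1) * f"
      by (simp only: right_diff_distrib mult_1_right power_add power_one_right mult.assoc)
    then show ?thesis
      unfolding pow_E
      by (simp only: X_def poly_mat_diff[OF A] poly_mat_mult[OF A] poly_mat_power[OF A] poly_mat_X[OF A])
  qed
  ultimately have "A ^\<^sub>m ?k - A ^\<^sub>m (?k + 1) * X = 0\<^sub>m n n"
    by simp
  from eq_mat_of_minus_eq_0[OF pow mult_carrier_mat[OF pow X] this]
  have "A ^\<^sub>m (?k + 1) * X = A ^\<^sub>m ?k"
    by (rule sym)
  with X A XAX AX have "is_drazin_inverse A X"
    unfolding is_drazin_inverse_def by (metis carrier_matD(1))
  then show ?thesis ..
qed

section \<open>Uniqueness of the Drazin inverse\<close>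

lemma pow_mat_commute:
  fixes A X :: "'a :: semiring_1 mat"
  assumes A: "A \<in> carrier_mat n n" and X: "X \<in> carrier_mat n n" and AX: "A * X = X * A"
  shows "A ^\<^sub>m i * X = X * A ^\<^sub>m i"
proof (induction i)
  case (Suc i)
  have "A ^\<^sub>m Suc i * X = A ^\<^sub>m i * (A * X)"
    using A X by (simp add: assoc_mult_mat[of _ n n _ n _ n])
  also have "\<dots> = A ^\<^sub>m i * X * A"
    unfolding AX using A X by (simp add: assoc_mult_mat[of _ n n _ n _ n])
  finally show ?case
    using A X by (simp add: Suc assoc_mult_mat[of _ n n _ n _ n])
qed (use A X in auto)

text \<open>By commutation X = X A X reads X = X X A, and iterating this gathers any number of
  factors A. It serves uniqueness and also puts the rows of every U X into the row spaces of all
  powers of A.\<close>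

lemma outer_inverse_eq_pow_mult_pow:
  fixes A X :: "'a :: semiring_1 mat"
  assumes A: "A \<in> carrier_mat n n" and X: "X \<in> carrier_mat n n"
    and XAX: "X * A * X = X" and AX: "A * X = X * A"
  shows "X = X ^\<^sub>m Suc i * A ^\<^sub>m i"
proof (induction i)
  case 0
  show ?case
    using A X by simp
next
  case (Suc i)
  have powA: "A ^\<^sub>m l \<in> carrier_mat n n" and powX: "X ^\<^sub>m l \<in> carrier_mat n n" for l
    using A X by auto
  have "X = X * (X * A)"
    by (metis AX XAX assoc_mult_mat[OF X A X])
  also have "\<dots> = X * (X ^\<^sub>m Suc i * A ^\<^sub>m i * A)"
    using Suc by simp
  also have "\<dots> = X * X ^\<^sub>m Suc i * (A ^\<^sub>m i * A)"
    unfolding assoc_mult_mat[OF powX powA A] assoc_mult_mat[OF X powX mult_carrier_mat[OF powA A]] ..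
  also have "X * X ^\<^sub>m Suc i = X ^\<^sub>m Suc (Suc i)"
    using pow_mat_add[OF X, of 1 "Suc i"] X by simp
  finally show ?case
    by simp
qed

text \<open>Both matrices equal X A Y. On one side X = X^(k+1) A^k = X^(k+1) A^(k+1) Y = X A Y; on
  the other, Y = A^k Y^(k+1) gives X A Y = X A^(k+1) Y^(k+1) = A^k Y^(k+1) = Y.\<close>

lemma is_drazin_inverse_unique:
  assumes A: "A \<in> carrier_mat n n" and X: "is_drazin_inverse A X" and Y: "is_drazin_inverse A Y"
  shows "X = Y"
proof -
  let ?k = "mat_index A"
  note dX = X[unfolded is_drazin_inverse_def] and dY = Y[unfolded is_drazin_inverse_def]
  have XC: "X \<in> carrier_mat n n" and YC: "Y \<in> carrier_mat n n"
    using dX dY A by auto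
  have powA: "A ^\<^sub>m l \<in> carrier_mat n n" and powX: "X ^\<^sub>m l \<in> carrier_mat n n"
    and powY: "Y ^\<^sub>m l \<in> carrier_mat n n" for l
    using A XC YC by auto
  have X_eq: "X = X ^\<^sub>m Suc ?k * A ^\<^sub>m ?k"
    using dX by (intro outer_inverse_eq_pow_mult_pow[OF A XC]) blast+
  have "Y = Y ^\<^sub>m Suc ?k * A ^\<^sub>m ?k"
    using dY by (intro outer_inverse_eq_pow_mult_pow[OF A YC]) blast+
  also have "\<dots> = A ^\<^sub>m ?k * Y ^\<^sub>m Suc ?k"
    using dY by (intro pow_mat_commute[OF YC powA] pow_mat_commute[OF A YC, symmetric]) blast
  finally have Y_eq: "Y = A ^\<^sub>m ?k * Y ^\<^sub>m Suc ?k" .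
  have Y_pow: "A ^\<^sub>m (?k + 1) * Y = A ^\<^sub>m ?k"
    using dY by simp
  have X_pow: "X * A ^\<^sub>m (?k + 1) = A ^\<^sub>m ?k"
    using dX pow_mat_commute[OF A XC, of "?k + 1"] by metis
  have "X = X ^\<^sub>m Suc ?k * (A ^\<^sub>m (?k + 1) * Y)"
    unfolding Y_pow by (rule X_eq)
  also have "\<dots> = X ^\<^sub>m Suc ?k * A ^\<^sub>m ?k * (A * Y)"
    using assoc_mult_mat[OF powX powA mult_carrier_mat[OF A YC], of "Suc ?k"] assoc_mult_mat[OF powA A YC]
    by (metis Suc_eq_plus1 pow_mat.simps(2))
  also have "\<dots> = X * (A * (A ^\<^sub>m ?k * Y ^\<^sub>m Suc ?k))"
    unfolding X_eq[symmetric] Y_eq[symmetric] ..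
  also have "\<dots> = X * A ^\<^sub>m (1 + ?k) * Y ^\<^sub>m Suc ?k"
  proof -
    have "A ^\<^sub>m (1 + ?k) = A * A ^\<^sub>m ?k"
      using pow_mat_add[OF A, of 1 ?k] A by simp
    then show ?thesis
      by (simp only: assoc_mult_mat[OF A powA powY] assoc_mult_mat[OF XC mult_carrier_mat[OF A powA] powY])
  qed
  also have "\<dots> = Y"
    unfolding add.commute[of 1] X_pow by (rule Y_eq[symmetric])
  finally show ?thesis .
qed

text \<open>Existence and uniqueness justify the definite description; the rank hypothesis says that
  the \<open>LEAST\<close> in \<open>mat_index\<close> is attained.\<close>

lemma is_drazin_inverse_drazin_inverse:
  assumes A: "A \<in> carrier_mat n n"
    and rank: "mat_rank (A ^\<^sub>m (mat_index A + 1)) = mat_rank (A ^\<^sub>m mat_index A)"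
  shows "is_drazin_inverse A (drazin_inverse A)"
proof -
  obtain X where "is_drazin_inverse A X"
    using drazin_inverse_exists[OF A mat_kernel_eq_of_mat_rank_eq[OF A rank]] by blast
  moreover from this have "Y = X" if "is_drazin_inverse A Y" for Y
    using is_drazin_inverse_unique[OF A that] by simp
  ultimately show ?thesis
    unfolding drazin_inverse_def by (rule theI)
qed

section \<open>The determinantal representation\<close>

text \<open>Lets the sum that defines the solution be read, and later differentiated, entry by
  entry.\<close>

lemma finsum_module_mat:
  fixes f :: "'b \<Rightarrow> 'a :: field mat"
  assumes "\<And>s. s \<in> S \<Longrightarrow> f s \<in> carrier_mat nr nc" and "finite S"
  shows "finsum (module_mat TYPE('a) nr nc) f S \<in> carrier_mat nr nc"
    and "i < nr \<Longrightarrow> j < nc \<Longrightarrow> finsum (module_mat TYPE('a) nr nc) f S $$ (i, j) = (\<Sum>s\<in>S. f s $$ (i, j))"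
proof -
  interpret abelian_group "module_mat TYPE('a) nr nc"
    by (rule abelian_group_mat)
  have "finsum (module_mat TYPE('a) nr nc) f S \<in> carrier_mat nr nc \<and>
      (\<forall>i<nr. \<forall>j<nc. finsum (module_mat TYPE('a) nr nc) f S $$ (i, j) = (\<Sum>s\<in>S. f s $$ (i, j)))"
    using assms(2,1)
  proof induction
    case (insert s S)
    have "finsum (module_mat TYPE('a) nr nc) f (insert s S) = f s + finsum (module_mat TYPE('a) nr nc) f S"
      using insert by (subst finsum_insert) (auto simp: module_mat_simps)
    with insert show ?case
      by auto
  qed (auto simp: module_mat_simps)
  then show "finsum (module_mat TYPE('a) nr nc) f S \<in> carrier_mat nr nc"
    and "i < nr \<Longrightarrow> j < nc \<Longrightarrow> finsum (module_mat TYPE('a) nr nc) f S $$ (i, j) = (\<Sum>s\<in>S. f s $$ (i, j))"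
    by auto
qed

section \<open>The order of the root 0 and the quotient of minors\<close>

lemma pow_mat_mult:
  fixes A :: "'a :: semiring_1 mat"
  assumes A: "A \<in> carrier_mat n n"
  shows "A ^\<^sub>m (i * j) = (A ^\<^sub>m i) ^\<^sub>m j"
proof (induction j)
  case (Suc j)
  have "A ^\<^sub>m (i * Suc j) = A ^\<^sub>m (i * j + i)"
    by (simp add: add.commute)
  then show ?case
    by (simp only: pow_mat_add[OF A] Suc pow_mat.simps)
qed (use A in auto)

text \<open>Splitting off the full power of t leaves a cofactor whose constant term is this
  coefficient. It is the source of the nonzero denominator.\<close>

lemma coeff_order_0_neq_0:
  fixes p :: "'a :: idom poly"
  assumes "p \<noteq> 0"
  shows "coeff p (order 0 p) \<noteq> 0"
proof -
  obtain q where q: "p = [:0, 1:] ^ order 0 p * q" "\<not> [:0, 1:] dvd q"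
    using order_decomp[OF assms, of 0] by auto
  then have "coeff p (order 0 p) = coeff (monom 1 (order 0 p) * q) (order 0 p)"
    by (simp add: monom_altdef)
  also have "\<dots> = coeff q 0"
    by (simp only: coeff_monom_mult) simp
  also have "\<dots> \<noteq> 0"
    using q(2) by (cases q) (auto simp: dvd_def)
  finally show ?thesis .
qed

text \<open>The determinant is the characteristic polynomial of -M, which has the same kernel and
  the same square as M; so the order of 0 is the nullity of M.\<close>

lemma order_0_det_shift_mat:
  fixes M :: "complex mat"
  assumes M: "M \<in> carrier_mat n n" and ker: "mat_kernel (M * M) = mat_kernel M"
  shows "det (shift_mat M) \<noteq> 0" and "order 0 (det (shift_mat M)) + mat_rank M = n"
proof -
  have N: "- M \<in> carrier_mat n n"
    using M by simp
  have "- M *\<^sub>v v = 0\<^sub>v n \<longleftrightarrow> M *\<^sub>v v = 0\<^sub>v n" if "v \<in> carrier_vec n" for v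
    using M that by (auto simp: vec_eq_iff)
  then have ker_uminus: "mat_kernel (- M) = mat_kernel M"
    unfolding mat_kernel[OF N] mat_kernel[OF M] by auto
  have "- M * - M = M * M"
    using M by (intro eq_matI) auto
  then have order: "order 0 (char_poly (- M)) = kernel_dim (- M)"
    by (intro order_0_char_poly[OF N]) (simp add: ker_uminus ker)
  have "shift_mat M = char_poly_matrix (- M)"
    using M by (intro eq_matI) (auto simp: shift_mat_def char_poly_matrix_def)
  then have det: "det (shift_mat M) = char_poly (- M)"
    by (simp add: char_poly_def)
  show "det (shift_mat M) \<noteq> 0"
    using degree_monic_char_poly[OF N] unfolding det by auto
  have "kernel_dim (- M) = kernel_dim M"
    using M by (simp add: kernel_dim_def ker_uminus)
  then show "order 0 (det (shift_mat M)) + mat_rank M = n"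
    using rank_plus_kernel_dim[OF M] M by (simp add: det order mat_rank_def)
qed

lemma drazin_inverse_props:
  assumes A: "A \<in> carrier_mat n n"
    and rank: "mat_rank (A ^\<^sub>m (mat_index A + 1)) = mat_rank (A ^\<^sub>m mat_index A)"
  shows "drazin_inverse A \<in> carrier_mat n n"
    and "A ^\<^sub>m (mat_index A + 1) * drazin_inverse A = A ^\<^sub>m mat_index A"
    and "drazin_inverse A * A * drazin_inverse A = drazin_inverse A"
    and "A * drazin_inverse A = drazin_inverse A * A"
  using is_drazin_inverse_drazin_inverse[OF A rank] A unfolding is_drazin_inverse_def by auto

text \<open>Cramer's rule above is applied to W = U D with D the Drazin inverse and M = A^(k+1): the
  defining equations give W M = U A^k.\<close>

lemma mult_drazin_inverse_index:
  assumes A: "A \<in> carrier_mat n n" and index: "mat_index A = k"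
    and rank_Suc: "mat_rank (A ^\<^sub>m (k + 1)) = r" and rank: "mat_rank (A ^\<^sub>m k) = r"
    and U: "U \<in> carrier_mat m n" and i: "i < m" and j: "j < n"
  shows "(U * drazin_inverse A) $$ (i, j) =
    (\<Sum>\<alpha>\<in>index_sets_containing r n j.
        principal_minor (replace_row (A ^\<^sub>m (k + 1)) j (row (U * A ^\<^sub>m k) i)) \<alpha>) /
    (\<Sum>\<alpha>\<in>index_sets r n. principal_minor (A ^\<^sub>m (k + 1)) \<alpha>)"
proof -
  define D where "D = drazin_inverse A"
  define M where "M = A ^\<^sub>m (k + 1)"
  have rank_eq: "mat_rank (A ^\<^sub>m (mat_index A + 1)) = mat_rank (A ^\<^sub>m mat_index A)"
    using rank rank_Suc index by simp
  note D = drazin_inverse_props[OF A rank_eq, folded D_def, unfolded index, folded M_def]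
  have M: "M \<in> carrier_mat n n"
    unfolding M_def by (rule pow_carrier_mat[OF A])
  have powA: "A ^\<^sub>m l \<in> carrier_mat n n" and powD: "D ^\<^sub>m l \<in> carrier_mat n n"
    and powM: "M ^\<^sub>m l \<in> carrier_mat n n" for l
    using A D(1) M by auto
  have ker: "mat_kernel (A ^\<^sub>m (l + k)) = mat_kernel (A ^\<^sub>m k)" for l
    using mat_kernel_pow_stable[OF A mat_kernel_eq_of_mat_rank_eq[OF A rank_eq], of l]
    by (simp only: index)
  \<comment> \<open>M and its square are powers of A with exponents at least k, where the kernels no
    longer change.\<close>
  have "M * M = A ^\<^sub>m ((k + 2) + k)"
    unfolding M_def pow_mat_add[OF A, symmetric] by (rule arg_cong[where f = "(^\<^sub>m) A"]) simp
  moreover have "M = A ^\<^sub>m (1 + k)"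
    unfolding M_def by (simp only: add.commute)
  ultimately have "mat_kernel (M * M) = mat_kernel M"
    by (simp only: ker)
  note order = order_0_det_shift_mat[OF M this]
  have n_minus_r: "n - r = order 0 (det (shift_mat M))" and r: "r \<le> n"
    using order(2) rank_Suc by (simp_all add: M_def)
  have dvd: "[:0, 1:] ^ (n - r) dvd det (shift_mat M)"
    using order_1[of 0 "det (shift_mat M)"] by (simp add: n_minus_r)
  \<comment> \<open>As n - r is the exact order of the root 0, the denominator is the lowest nonzero
    coefficient.\<close>
  have nz: "(\<Sum>\<alpha>\<in>index_sets r n. principal_minor M \<alpha>) \<noteq> 0"
    using coeff_order_0_neq_0[OF order(1)] by (simp add: coeff_det_shift_mat[OF M r, symmetric] n_minus_r)
  \<comment> \<open>Chosen so that A to the power \<open>?N\<close> is M^(n - r).\<close>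
  let ?N = "(k + 1) * (n - r)"
  have "U * D = U * (D ^\<^sub>m Suc ?N * A ^\<^sub>m ?N)"
    using outer_inverse_eq_pow_mult_pow[OF A D(1) D(3,4), of ?N] by (rule arg_cong)
  also have "\<dots> = U * D ^\<^sub>m Suc ?N * M ^\<^sub>m (n - r)"
    unfolding M_def pow_mat_mult[OF A, symmetric] by (rule assoc_mult_mat[symmetric, OF U powD powA])
  finally have UD: "U * D = U * D ^\<^sub>m Suc ?N * M ^\<^sub>m (n - r)" .
  have "U * D * M = U * (D * M)"
    by (rule assoc_mult_mat[OF U D(1) M])
  also have "D * M = M * D"
    unfolding M_def by (rule pow_mat_commute[OF A D(1,4), symmetric])
  also have "M * D = A ^\<^sub>m k"
    by (rule D(2))
  finally have "U * D * M = U * A ^\<^sub>m k" .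
  moreover have "(\<Sum>\<alpha>\<in>index_sets_containing r n j. principal_minor (replace_row M j (row (U * D * M) i)) \<alpha>) =
    (U * D) $$ (i, j) * (\<Sum>\<alpha>\<in>index_sets r n. principal_minor M \<alpha>)"
    using sum_principal_minors_replace_row[OF M mult_carrier_mat[OF U D(1)] i j r dvd UD
        mult_carrier_mat[OF U powD]] .
  ultimately show ?thesis
    using nz by (simp add: M_def D_def del: pow_mat.simps)
qed

text \<open>A possible index s = 0 is harmless despite the truncated \<open>s - 1\<close>, because
  its factor \<open>of_nat s\<close> is 0.\<close>

lemma has_vector_derivative_power_sum:
  fixes c :: "nat \<Rightarrow> complex"
  shows "((\<lambda>u. a + (\<Sum>s\<in>S. c s * complex_of_real u ^ s)) has_vector_derivative
    (\<Sum>s\<in>S. c s * (of_nat s * complex_of_real t ^ (s - 1)))) (at t)"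
proof -
  have "((\<lambda>u. complex_of_real u ^ s) has_vector_derivative of_nat s * complex_of_real t ^ (s - 1)) (at t)" for s
    by (auto intro!: derivative_eq_intros has_vector_derivative_real_field)
  then show ?thesis
    by (auto intro!: derivative_eq_intros)
qed

theorem theorem4p3:
  fixes n k r :: nat
    and A B :: "complex mat"
    and Bc :: "nat \<Rightarrow> complex mat"
    and X :: "real \<Rightarrow> complex mat"
  assumes A: "A \<in> carrier_mat n n"
    and B: "B \<in> carrier_mat n n"
    and singular: "\<not> invertible_mat A"
    and index: "mat_index A = k"
    and rank_Suc: "mat_rank (A ^\<^sub>m (k + 1)) = r"
    and rank: "mat_rank (A ^\<^sub>m k) = r"
    and r: "r \<ge> 1"
    and Bc: "\<And>l. Bc l = B * A ^\<^sub>m l"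
    and X: "\<And>t. X t =
      B * drazin_inverse A +
      finsum (module_mat TYPE(complex) n n)
        (\<lambda>s. ((-1) ^ (s - 1) / fact s * complex_of_real t ^ s) \<cdot>\<^sub>m
              (B * A ^\<^sub>m (s - 1) - B * A ^\<^sub>m s * drazin_inverse A))
        {1..k}"
  shows "solves_mat_ode n A B X \<and>
    (\<forall>t. \<forall>i<n. \<forall>j<n.
      X t $$ (i, j) =
        (\<Sum>\<alpha>\<in>index_sets_containing r n j.
            principal_minor (replace_row (A ^\<^sub>m (k + 1)) j (row (Bc k) i)) \<alpha>) /
        (\<Sum>\<alpha>\<in>index_sets r n. principal_minor (A ^\<^sub>m (k + 1)) \<alpha>) +
        (\<Sum>s = 1..k. (-1) ^ (s - 1) / fact s *
          (Bc (s - 1) $$ (i, j) -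
            (\<Sum>\<alpha>\<in>index_sets_containing r n j.
                principal_minor (replace_row (A ^\<^sub>m (k + 1)) j (row (Bc (k + s)) i)) \<alpha>) /
            (\<Sum>\<alpha>\<in>index_sets r n. principal_minor (A ^\<^sub>m (k + 1)) \<alpha>)) *
          complex_of_real t ^ s))"
proof -
  define D where "D = drazin_inverse A"
  have rank_eq: "mat_rank (A ^\<^sub>m (mat_index A + 1)) = mat_rank (A ^\<^sub>m mat_index A)"
    using rank rank_Suc index by simp
  note D = drazin_inverse_props[OF A rank_eq, folded D_def, unfolded index]
  have powA: "A ^\<^sub>m l \<in> carrier_mat n n" and BA: "B * A ^\<^sub>m l \<in> carrier_mat n n"
    and BAD: "B * A ^\<^sub>m l * D \<in> carrier_mat n n" for l
    using A B D(1) by auto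
  \<comment> \<open>For s \<ge> 1 this is B A^(s-1) (I - A D), the coefficient of t^s without its
    scalar.\<close>
  define C where "C s = B * A ^\<^sub>m (s - 1) - B * A ^\<^sub>m s * D" for s
  have C: "C s \<in> carrier_mat n n" for s
    unfolding C_def by (rule minus_carrier_mat[OF BAD])
  let ?c = "\<lambda>s. (-1) ^ (s - 1) / fact s :: complex"
  have X_carrier: "X t \<in> carrier_mat n n" for t
    unfolding X D_def[symmetric] C_def[symmetric] using B D(1) C
    by (intro add_carrier_mat finsum_module_mat) auto
  have X_index: "X t $$ (i, j) = (B * D) $$ (i, j) +
      (\<Sum>s = 1..k. ?c s * C s $$ (i, j) * complex_of_real t ^ s)" if ij: "i < n" "j < n" for t i j
  proof -
    have "X t $$ (i, j) = (B * D) $$ (i, j) + finsum (module_mat TYPE(complex) n n)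
        (\<lambda>s. (?c s * complex_of_real t ^ s) \<cdot>\<^sub>m C s) {1..k} $$ (i, j)"
      unfolding X D_def[symmetric] C_def[symmetric]
      using ij B D(1) C finsum_module_mat(1)[of "{1..k}" "\<lambda>s. (?c s * complex_of_real t ^ s) \<cdot>\<^sub>m C s" n n]
      by (subst index_add_mat) auto
    also have "finsum (module_mat TYPE(complex) n n)
        (\<lambda>s. (?c s * complex_of_real t ^ s) \<cdot>\<^sub>m C s) {1..k} $$ (i, j) =
        (\<Sum>s = 1..k. ((?c s * complex_of_real t ^ s) \<cdot>\<^sub>m C s) $$ (i, j))"
      using ij C by (intro finsum_module_mat(2)) auto
    also have "\<dots> = (\<Sum>s = 1..k. ?c s * C s $$ (i, j) * complex_of_real t ^ s)"
      using ij carrier_matD[OF C] by (intro sum.cong) auto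
    finally show ?thesis .
  qed

  \<comment> \<open>D commutes with A, so a factor A on the right only raises the exponents; s \<ge>
    1 makes \<open>s - 1\<close> a true predecessor.\<close>
  have C_mult: "C s * A = C (Suc s)" if "s \<ge> 1" for s
  proof -
    obtain l where s: "s = Suc l"
      using \<open>s \<ge> 1\<close> by (cases s) auto
    have "C s * A = B * A ^\<^sub>m l * A - B * A ^\<^sub>m s * D * A"
      unfolding C_def s by (simp only: minus_mult_distrib_mat[OF BA BAD A] diff_Suc_1)
    also have "B * A ^\<^sub>m l * A = B * A ^\<^sub>m s"
      unfolding s by (simp add: assoc_mult_mat[OF B powA A])
    also have "B * A ^\<^sub>m s * D * A = B * A ^\<^sub>m s * (A * D)"
      unfolding D(4) by (rule assoc_mult_mat[OF BA D(1) A])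
    also have "\<dots> = B * A ^\<^sub>m Suc s * D"
      by (simp add: assoc_mult_mat[OF BA A D(1), symmetric] assoc_mult_mat[OF B powA A])
    finally show ?thesis
      by (simp add: C_def)
  qed
  have C_1: "C (Suc 0) = B - B * D * A"
    using A B D(1,4) by (simp add: C_def assoc_mult_mat[of _ n n _ n _ n])
  \<comment> \<open>The chain of coefficients ends here, because A^(k+1) D = A^k.\<close>
  have C_Suc_k: "C (Suc k) = 0\<^sub>m n n"
  proof -
    have "B * A ^\<^sub>m Suc k * D = B * (A ^\<^sub>m (k + 1) * D)"
      unfolding Suc_eq_plus1 by (rule assoc_mult_mat[OF B powA D(1)])
    then have "C (Suc k) = B * A ^\<^sub>m k - B * A ^\<^sub>m k"
      by (simp only: C_def D(2) diff_Suc_1)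
    then show ?thesis
      using BA[of k] by auto
  qed

  \<comment> \<open>The differential equation\<close>
  have "solves_mat_ode n A B X"
    unfolding solves_mat_ode_def
  proof (intro allI conjI exI)
    fix t :: real
    show "X t \<in> carrier_mat n n"
      by (rule X_carrier)
    define E where "E = mat n n (\<lambda>(i, j).
        \<Sum>s = 1..k. ?c s * C s $$ (i, j) * (of_nat s * complex_of_real t ^ (s - 1)))"
    show "has_mat_derivative n X E t"
      unfolding has_mat_derivative_def
    proof (intro conjI allI impI)
      fix i j assume ij: "i < n" "j < n"
      then show "((\<lambda>u. X u $$ (i, j)) has_vector_derivative E $$ (i, j)) (at t)"
        using has_vector_derivative_power_sum[of "(B * D) $$ (i, j)" "\<lambda>s. ?c s * C s $$ (i, j)" "{1..k}"]
        by (simp only: X_index[OF ij] E_def index_mat case_prod_conv)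
    qed (simp add: E_def)
    show "E + X t * A = B"
    proof (rule eq_matI)
      fix i j assume "i < dim_row B" "j < dim_col B"
      then have ij: "i < n" "j < n"
        using B by auto
      \<comment> \<open>The common term of both sums: since s / s! = 1 / (s - 1)!, term s of the
        derivative is \<open>g (s - 1)\<close>, while term s of X A is \<open>- g s\<close>.\<close>
      define g where "g s = (-1) ^ s / fact s * complex_of_real t ^ s * C (Suc s) $$ (i, j)" for s
      have "E $$ (i, j) = (\<Sum>s = 1..k. g (s - 1))"
      proof -
        have "?c s * C s $$ (i, j) * (of_nat s * complex_of_real t ^ (s - 1)) = g (s - 1)"
          if "s \<in> {1..k}" for s
        proof -
          obtain l where s: "s = Suc l"
            using \<open>s \<in> {1..k}\<close> by (cases s) auto
          have "(of_nat (Suc l) :: complex) \<noteq> 0"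
            by (simp del: of_nat_Suc)
          then show ?thesis
            by (simp add: s g_def fact_Suc field_simps del: of_nat_Suc)
        qed
        then show ?thesis
          using ij by (simp add: E_def)
      qed
      also have "\<dots> = (\<Sum>s<k. g s)"
        by (simp add: sum.atLeast1_atMost_eq)
      finally have E_index: "E $$ (i, j) = (\<Sum>s<k. g s)" .
      have mult_index: "(W * A) $$ (i, j) = (\<Sum>b<n. W $$ (i, b) * A $$ (b, j))"
        if "W \<in> carrier_mat n n" for W
        using that A ij by (auto simp: scalar_prod_def atLeast0LessThan intro!: sum.cong)
      have "(X t * A) $$ (i, j) = (\<Sum>b<n. (B * D) $$ (i, b) * A $$ (b, j)) +
          (\<Sum>s = 1..k. ?c s * complex_of_real t ^ s * (\<Sum>b<n. C s $$ (i, b) * A $$ (b, j)))"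
      proof -
        have "(X t * A) $$ (i, j) = (\<Sum>b<n. (B * D) $$ (i, b) * A $$ (b, j) +
            (\<Sum>s = 1..k. ?c s * complex_of_real t ^ s * (C s $$ (i, b) * A $$ (b, j))))"
          unfolding mult_index[OF X_carrier] using ij(1)
          by (intro sum.cong) (simp_all only: X_index lessThan_iff distrib_left sum_distrib_left ac_simps)
        also have "\<dots> = (\<Sum>b<n. (B * D) $$ (i, b) * A $$ (b, j)) +
            (\<Sum>s = 1..k. \<Sum>b<n. ?c s * complex_of_real t ^ s * (C s $$ (i, b) * A $$ (b, j)))"
          by (simp only: sum.distrib sum.swap[of _ "{1..k}"])
        finally show ?thesis
          by (simp only: sum_distrib_left)
      qed
      also have "\<dots> = (B * D * A) $$ (i, j) + (\<Sum>s = 1..k. - g s)"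
      proof -
        have "?c s * complex_of_real t ^ s * (\<Sum>b<n. C s $$ (i, b) * A $$ (b, j)) = - g s"
          if "s \<in> {1..k}" for s
          using that C_mult[of s] by (cases s) (auto simp: mult_index[OF C, symmetric] g_def)
        then show ?thesis
          using B D(1) by (simp add: mult_index)
      qed
      finally have "(E + X t * A) $$ (i, j) =
          (B * D * A) $$ (i, j) + ((\<Sum>s<k. g s) - (\<Sum>s<k. g (Suc s)))"
        using ij A X_carrier[of t] E_index by (simp add: sum.atLeast1_atMost_eq sum_negf E_def)
      also have "(\<Sum>s<k. g s) - (\<Sum>s<k. g (Suc s)) = g 0 - g k"
        by (simp only: sum_subtractf[symmetric] sum_lessThan_telescope')
      also have "g k = 0"
        using ij by (simp add: g_def C_Suc_k)
      \<comment> \<open>The surviving end of the telescope supplies B and cancels B D A, which came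
        from the constant term of X.\<close>
      also have "g 0 = B $$ (i, j) - (B * D * A) $$ (i, j)"
        using ij A B D(1) by (simp add: g_def C_1)
      finally show "(E + X t * A) $$ (i, j) = B $$ (i, j)"
        by simp
    qed (use A B carrier_matD[OF X_carrier[of t]] in \<open>auto simp: E_def\<close>)
  qed

  \<comment> \<open>The entries of the solution\<close>
  moreover have "X t $$ (i, j) =
        (\<Sum>\<alpha>\<in>index_sets_containing r n j.
            principal_minor (replace_row (A ^\<^sub>m (k + 1)) j (row (Bc k) i)) \<alpha>) /
        (\<Sum>\<alpha>\<in>index_sets r n. principal_minor (A ^\<^sub>m (k + 1)) \<alpha>) +
        (\<Sum>s = 1..k. (-1) ^ (s - 1) / fact s *
          (Bc (s - 1) $$ (i, j) -
            (\<Sum>\<alpha>\<in>index_sets_containing r n j.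
                principal_minor (replace_row (A ^\<^sub>m (k + 1)) j (row (Bc (k + s)) i)) \<alpha>) /
            (\<Sum>\<alpha>\<in>index_sets r n. principal_minor (A ^\<^sub>m (k + 1)) \<alpha>)) *
          complex_of_real t ^ s)" if ij: "i < n" "j < n" for t i j
  proof -
    \<comment> \<open>Used with U = B for the constant term and with U = B A^s for the term s, where
      U A^k is \<open>Bc (k + s)\<close>.\<close>
    note minors = mult_drazin_inverse_index[OF A index rank_Suc rank _ ij, folded D_def, symmetric]
    have "Bc (k + s) = B * A ^\<^sub>m s * A ^\<^sub>m k" for s
      unfolding Bc add.commute[of k] pow_mat_add[OF A] by (rule assoc_mult_mat[symmetric, OF B powA powA])
    moreover have "C s $$ (i, j) = Bc (s - 1) $$ (i, j) - (B * A ^\<^sub>m s * D) $$ (i, j)" for s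
      unfolding C_def Bc using ij carrier_matD[OF BAD] by (intro index_minus_mat) auto
    moreover have "Bc k = B * A ^\<^sub>m k"
      by (rule Bc)
    ultimately show ?thesis
      by (simp only: X_index[OF ij] minors[OF B] minors[OF BA])
  qed
  ultimately show ?thesis
    by blast
qed

end
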